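(* Let $w\subset\mathbb{R}^d$ be a (closed) strongly martingale connected domain and let $f\colon\partial_{\mathrm{fixed}}w\to\mathbb{R}$ be a Borel measurable, locally bounded function that is bounded from below. Suppose that $\mathfrak{B}_{w,f}$ is continuous at every point of $\partial_{\mathrm{fixed}}w$. Then $\mathfrak{B}_{w,f}(x)=\mathcal{B}_{w,f}(x)$ for every $x\in w$.
   Context: For $w\subset\mathbb{R}^d$, a point $x\in\partial w$ is locally extremal if there is no open segment $\ell\subset\mathrm{cl}\,w$ with $x\in\ell$; the set of such points is the fixed boundary $\partial_{\mathrm{fixed}}w$. A function $G\colon w\to\mathbb{R}\cup\{+\infty\}$ is locally concave if its restriction to every segment contained in $w$ is concave. $\Lambda_{w,f}$ is the set of locally concave $G\colon w\to\mathbb{R}\cup\{+\infty\}$ with $G\ge f$ on $\partial_{\mathrm{fixed}}w$, and $\mathfrak{B}_{w,f}(x)=\inf_{G\in\Lambda_{w,f}}G(x)$. Martingales are discrete-time, over an increasing filtration $\{S_n\}_{n\ge0}$ of finite algebras on the standard probability space $(\mathfrak{S},P)$. For closed $w$, an $\mathbb{R}^d$-valued martingale $M$ adapted to $\{S_n\}$ is a $w$-martingale if: (i) $S_0=\{\emptyset,\mathfrak{S}\}$; (ii) there is a random variable $M_\infty$ with values in $\partial_{\mathrm{fixed}}w$, $\mathbb{E}|M_\infty|<\infty$ and $M_n=\mathbb{E}(M_\infty\mid S_n)$; (iii) for every $n\ge 0$ and every atom $\sigma$ of $S_n$, $\mathrm{conv}\big(M_n(\sigma),\{M_{n+1}(z)\}_{z\in\sigma}\big)\subset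 w$. The set of all $w$-martingales is $\mathcal{M}_w$. A $w$-martingale is simple if $M_n=M_\infty$ for some $n$. The set $w$ is strongly martingale connected if for every $x\in w$ there is a simple $w$-martingale with $M_0=x$. The martingale Bellman function is $$\mathcal{B}_{w,f}(x)=\sup\{\mathbb{E}f(M_\infty):\ M\in\mathcal{M}_w,\ M_0=x\},\quad x\in w.$$
   Formalization: In the definition of a w-martingale, M_n is additionally required to converge to M_∞ almost surely; without this the claim fails, e.g. for the annulus 1≤|x|≤2 with f=−|x_2| at the point (1,0). *)

theory Defs
  imports "HOL-Probability.Probability"
begin

definition fixed_boundary :: "'a::euclidean_space set \<Rightarrow> 'a set" where
  "fixed_boundary w =
     {x \<in> frontier w. \<not> (\<exists>a b. open_segment a b \<subseteq> closure w \<and> x \<in> open_segment a b)}"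

(* concave_on is restricted to real-valued functions; here G takes values in the reals together
   with +infinity, so the right-hand side below never has the form infinity - infinity. *)
definition ext_concave_on :: "'a::euclidean_space set \<Rightarrow> ('a \<Rightarrow> ereal) \<Rightarrow> bool" where
  "ext_concave_on S G \<longleftrightarrow> convex S \<and> (\<forall>x\<in>S. G x \<noteq> -\<infinity>) \<and>
     (\<forall>x\<in>S. \<forall>y\<in>S. \<forall>t\<in>{0..1::real}.
        G ((1 - t) *\<^sub>R x + t *\<^sub>R y) \<ge> ereal (1 - t) * G x + ereal t * G y)"

definition locally_concave_on :: "'a::euclidean_space set \<Rightarrow> ('a \<Rightarrow> ereal) \<Rightarrow> bool" where
  "locally_concave_on w G \<longleftrightarrow>
     (\<forall>a b. closed_segment a b \<subseteq> w \<longrightarrow> ext_concave_on (closed_segment a b) G)"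

definition concave_majorants ::
    "'a::euclidean_space set \<Rightarrow> ('a \<Rightarrow> real) \<Rightarrow> ('a \<Rightarrow> ereal) set" where
  "concave_majorants w f =
     {G. (\<forall>x\<in>w. G x \<noteq> -\<infinity>) \<and> locally_concave_on w G \<and>
         (\<forall>x\<in>fixed_boundary w. G x \<ge> ereal (f x))}"

definition minimal_concave :: "'a::euclidean_space set \<Rightarrow> ('a \<Rightarrow> real) \<Rightarrow> 'a \<Rightarrow> ereal" where
  "minimal_concave w f x = (INF G\<in>concave_majorants w f. G x)"

(* The standard (atomless) probability space, realised as the unit interval. *)
definition std_space :: "real measure" where
  "std_space = restrict_space lborel {0..1}"

definition atom_of :: "'b set set \<Rightarrow> 'b set \<Rightarrow> bool" where
  "atom_of \<A> \<sigma> \<longleftrightarrow> \<sigma> \<in> \<A> \<and> \<sigma> \<noteq> {} \<and> (\<forall>A\<in>\<A>. A \<subseteq> \<sigma> \<longrightarrow> A = {} \<or> A = \<sigma>)"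

definition finite_filtration :: "'b measure \<Rightarrow> (nat \<Rightarrow> 'b set set) \<Rightarrow> bool" where
  "finite_filtration P S \<longleftrightarrow>
     (\<forall>n. finite (S n) \<and> algebra (space P) (S n) \<and> S n \<subseteq> sets P \<and> S n \<subseteq> S (Suc n))"

(* X is a version of E(Y | A) for vector-valued Y; the library's real_cond_exp is real-valued. *)
definition is_cond_exp ::
    "'b measure \<Rightarrow> 'b set set \<Rightarrow> ('b \<Rightarrow> 'a::euclidean_space) \<Rightarrow> ('b \<Rightarrow> 'a) \<Rightarrow> bool" where
  "is_cond_exp P \<A> Y X \<longleftrightarrow>
     X \<in> borel_measurable (sigma (space P) \<A>) \<and> integrable P X \<and>
     (\<forall>A\<in>\<A>. set_lebesgue_integral P A X = set_lebesgue_integral P A Y)"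

(* The clause on almost sure convergence expresses that Minf is the terminal value of M.
   By Levy's theorem it amounts to Minf being measurable (modulo null sets) with respect to the
   sigma-algebra generated by all S n. It does not follow from the other clauses: without it, the
   trivial filtration with M constantly x would admit every Minf of mean x. *)
definition w_martingale ::
    "'a::euclidean_space set \<Rightarrow> (nat \<Rightarrow> real set set) \<Rightarrow> (nat \<Rightarrow> real \<Rightarrow> 'a) \<Rightarrow> (real \<Rightarrow> 'a) \<Rightarrow> bool" where
  "w_martingale w S M Minf \<longleftrightarrow>
     finite_filtration std_space S \<and>
     S 0 = {{}, space std_space} \<and>
     Minf \<in> borel_measurable std_space \<and>
     (\<forall>z\<in>space std_space. Minf z \<in> fixed_boundary w) \<and>
     integrable std_space Minf \<and>
     (\<forall>n. is_cond_exp std_space (S n) Minf (M n)) \<and>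
     (AE z in std_space. (\<lambda>n. M n z) \<longlonglongrightarrow> Minf z) \<and>
     (\<forall>n \<sigma>. atom_of (S n) \<sigma> \<longrightarrow> convex hull (M n ` \<sigma> \<union> M (Suc n) ` \<sigma>) \<subseteq> w)"

definition starts_at :: "(nat \<Rightarrow> real \<Rightarrow> 'a) \<Rightarrow> 'a \<Rightarrow> bool" where
  "starts_at M x \<longleftrightarrow> (\<forall>z\<in>space std_space. M 0 z = x)"

definition simple_w_martingale ::
    "'a::euclidean_space set \<Rightarrow> (nat \<Rightarrow> real set set) \<Rightarrow> (nat \<Rightarrow> real \<Rightarrow> 'a) \<Rightarrow> (real \<Rightarrow> 'a) \<Rightarrow> bool" where
  "simple_w_martingale w S M Minf \<longleftrightarrow>
     w_martingale w S M Minf \<and> (\<exists>n. AE z in std_space. M n z = Minf z)"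

definition strongly_martingale_connected :: "'a::euclidean_space set \<Rightarrow> bool" where
  "strongly_martingale_connected w \<longleftrightarrow>
     (\<forall>x\<in>w. \<exists>S M Minf. simple_w_martingale w S M Minf \<and> starts_at M x)"

(* Integral of a real function with values in the extended reals: positive part minus negative
   part (ennreal truncates negative reals to 0). For g bounded from below on a finite measure
   space the second term is finite. *)
definition ext_integral :: "'b measure \<Rightarrow> ('b \<Rightarrow> real) \<Rightarrow> ereal" where
  "ext_integral P g =
     enn2ereal (\<integral>\<^sup>+ z. ennreal (g z) \<partial>P) - enn2ereal (\<integral>\<^sup>+ z. ennreal (- g z) \<partial>P)"

definition martingale_bellman :: "'a::euclidean_space set \<Rightarrow> ('a \<Rightarrow> real) \<Rightarrow> 'a \<Rightarrow> ereal" where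
  "martingale_bellman w f x =
     Sup {ext_integral std_space (\<lambda>z. f (Minf z)) | S M Minf.
            w_martingale w S M Minf \<and> starts_at M x}"

definition locally_bounded_on :: "'a::topological_space set \<Rightarrow> ('a \<Rightarrow> real) \<Rightarrow> bool" where
  "locally_bounded_on A f \<longleftrightarrow> (\<forall>x\<in>A. \<exists>U. open U \<and> x \<in> U \<and> bounded (f ` (U \<inter> A)))"

end

theory Submission
  imports Defs
begin

text \<open>
  A locally concave \<open>G\<close> dominates the expectation of its values along a \<open>w\<close>-martingale, by
  Jensen's inequality on the convex hulls required to lie in \<open>w\<close>. Applied to a simple martingale
  this bounds every majorant from below by \<open>inf f\<close>; applied to truncations of the minimal
  majorant, with Fatou's lemma and continuity on the fixed boundary, it shows that the martingale
  Bellman function is at most the minimal one. Conversely, running one martingale on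
  \<open>[0, s)\<close> and another on \<open>[s, 1]\<close>, both rescaled, shows that the martingale Bellman function
  is itself locally concave, hence one of the majorants.
\<close>

text \<open>A majorant may be infinite and carries no measurability. Finiteness of the algebras
  \<open>S n\<close> meets this: \<open>M n\<close> has finitely many values, so every real function
  of \<open>M n\<close> is integrable and Jensen's inequality on an atom is a statement about a
  finite convex combination. Truncation from above keeps concavity and makes all values real. A
  simple martingale reaches the fixed boundary at a finite time, so the lower bound holds for each
  majorant separately and passes to the infimum, which therefore never equals -infinity. A general
  martingale reaches the boundary only in the limit, whereas Jensen's inequality controls finite
  times. Continuity of the minimal majorant bridges this gap, and so the upper bound is proved for
  that majorant directly. Gluing inserts one extra step at the start, from a point of a segment to
  one of its ends. That step stays inside the segment, so concavity is obtained exactly along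
  segments contained in \<open>w\<close>.\<close>

lemma space_std_space [simp]: "space std_space = {0..1}"
  by (simp add: std_space_def space_restrict_space)

interpretation std: prob_space std_space
  by standard (simp add: std_space_def emeasure_restrict_space space_restrict_space)

section \<open>Gluing two functions on complementary subintervals\<close>

text \<open>The break point \<open>s\<close> belongs to the second piece, so the value of
  \<open>g\<close> at 1 is lost; this affects only a null set. The result type is arbitrary because
  the operation is also applied to predicates and to indicator functions.\<close>

definition glue :: "real \<Rightarrow> (real \<Rightarrow> 'b) \<Rightarrow> (real \<Rightarrow> 'b) \<Rightarrow> real \<Rightarrow> 'b" where
  "glue s g h z = (if z < s then g (z / s) else h ((z - s) / (1 - s)))"

context
  fixes s :: real
  assumes s: "0 < s" "s < 1"
begin

lemma glue_arg:
  "z \<in> {0..1} \<Longrightarrow> z < s \<Longrightarrow> z / s \<in> {0..1}"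
  "z \<in> {0..1} \<Longrightarrow> \<not> z < s \<Longrightarrow> (z - s) / (1 - s) \<in> {0..1}"
  using s by (auto simp: field_simps)

lemma measurable_glue:
  assumes "g \<in> measurable std_space N" "h \<in> measurable std_space N"
  shows "glue s g h \<in> measurable std_space N"
proof -
  have p: "{z \<in> space std_space. z < s} \<in> sets std_space"
    by (auto simp: std_space_def sets_restrict_space space_restrict_space image_iff
        intro!: bexI[of _ "{..<s}"])
  have a: "(\<lambda>z. z / s) \<in> measurable (restrict_space std_space {z. z < s}) std_space"
    using s unfolding std_space_def
    by (intro measurable_restrict_space2)
       (auto simp: space_restrict_space field_simps intro!: measurable_restrict_space1)
  have b: "(\<lambda>z. (z - s) / (1 - s)) \<in> measurable (restrict_space std_space {z. \<not> z < s}) std_space"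
    using s unfolding std_space_def
    by (intro measurable_restrict_space2)
       (auto simp: space_restrict_space field_simps intro!: measurable_restrict_space1)
  show ?thesis
    unfolding glue_def [abs_def] measurable_If_restrict_space_iff[OF p]
    using measurable_compose[OF a assms(1)] measurable_compose[OF b assms(2)] by simp
qed

text \<open>Affine substitution scales the two pieces by \<open>s\<close> and \<open>1 - s\<close>.
  Infinite values are allowed, as terminal payoffs may have infinite expectation.\<close>

lemma nn_integral_glue:
  fixes g h :: "real \<Rightarrow> ennreal"
  assumes g: "g \<in> borel_measurable std_space" and h: "h \<in> borel_measurable std_space"
  shows "(\<integral>\<^sup>+z. glue s g h z \<partial>std_space) =
    ennreal s * (\<integral>\<^sup>+z. g z \<partial>std_space) + ennreal (1 - s) * (\<integral>\<^sup>+z. h z \<partial>std_space)"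
proof -
  have std: "(\<integral>\<^sup>+z. k z \<partial>std_space) = (\<integral>\<^sup>+z. k z * indicator {0..1} z \<partial>lborel)" for k
    by (simp add: std_space_def nn_integral_restrict_space)
  have [measurable]: "(\<lambda>z. g z * indicator {0..1} z) \<in> borel_measurable borel"
    "(\<lambda>z. h z * indicator {0..1} z) \<in> borel_measurable borel"
    using g h by (auto simp: std_space_def borel_measurable_restrict_space_iff_ennreal)
  \<comment> \<open>Extension by zero lets the substitution act on the whole line. \<open>H\<close>
    vanishes at negative arguments and so needs no cut-off, while \<open>G (z / s)\<close> needs the
    factor \<open>indicator {..<s}\<close>: at \<open>z = s\<close> both pieces would otherwise
    count.\<close>
  define G H where "G = (\<lambda>z. g z * indicator {0..1} z)" and "H = (\<lambda>z. h z * indicator {0..1} z)"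
  have [measurable]: "G \<in> borel_measurable borel" "H \<in> borel_measurable borel"
    by (simp_all add: G_def H_def)
  have "(\<integral>\<^sup>+z. glue s g h z \<partial>std_space) =
      (\<integral>\<^sup>+z. G (z / s) * indicator {..<s} z + H ((z - s) / (1 - s)) \<partial>lborel)"
    unfolding std using s
    by (intro nn_integral_cong) (auto simp: glue_def G_def H_def field_simps split: split_indicator)
  also have "\<dots> = (\<integral>\<^sup>+z. G (z / s) * indicator {..<s} z \<partial>lborel) +
      (\<integral>\<^sup>+z. H ((z - s) / (1 - s)) \<partial>lborel)"
    by (intro nn_integral_add) auto
  also have "(\<integral>\<^sup>+z. G (z / s) * indicator {..<s} z \<partial>lborel) =
      ennreal s * (\<integral>\<^sup>+z. G z * indicator {..<1} z \<partial>lborel)"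
    using s by (subst nn_integral_real_affine[where c = s and t = 0])
      (auto intro!: arg_cong2[where f = times] nn_integral_cong split: split_indicator)
  also have "(\<integral>\<^sup>+z. G z * indicator {..<1} z \<partial>lborel) = (\<integral>\<^sup>+z. G z \<partial>lborel)"
    by (intro nn_integral_cong_AE AE_I[of _ _ "{1}"]) (auto simp: G_def split: split_indicator)
  also have "(\<integral>\<^sup>+z. H ((z - s) / (1 - s)) \<partial>lborel) = ennreal (1 - s) * (\<integral>\<^sup>+z. H z \<partial>lborel)"
    using s by (subst nn_integral_real_affine[where c = "1 - s" and t = s])
      (auto intro!: arg_cong2[where f = times] nn_integral_cong)
  finally show ?thesis
    unfolding std G_def H_def .
qed

text \<open>The vector-valued form serves the conditional expectations of the glued martingale;
  \<open>has_bochner_integral\<close> delivers integrability and the value together.\<close>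

lemma has_bochner_integral_glue:
  fixes g h :: "real \<Rightarrow> 'b::euclidean_space"
  assumes g: "integrable std_space g" and h: "integrable std_space h"
  shows "has_bochner_integral std_space (glue s g h)
    (s *\<^sub>R integral\<^sup>L std_space g + (1 - s) *\<^sub>R integral\<^sup>L std_space h)"
proof -
  define G H where "G = (\<lambda>z. indicator {0..1} z *\<^sub>R g z)" and "H = (\<lambda>z. indicator {0..1} z *\<^sub>R h z)"
  have "integrable lborel G" and iH: "integrable lborel H"
    using g h by (auto simp: std_space_def integrable_restrict_space G_def H_def)
  then have hG: "has_bochner_integral lborel G (integral\<^sup>L std_space g)"
    and hH: "has_bochner_integral lborel H (integral\<^sup>L std_space h)"
    by (auto simp: std_space_def integral_restrict_space G_def H_def has_bochner_integral_iff)
  have hG': "has_bochner_integral lborel (\<lambda>z. indicator {..<1} z *\<^sub>R G z) (integral\<^sup>L std_space g)"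
    using hG by (subst has_bochner_integral_discrete_difference[where X = "{1}" and g = G])
      (auto simp: G_def split: split_indicator)
  have "has_bochner_integral lborel (\<lambda>z. indicator {..<s} z *\<^sub>R G (z / s)) (s *\<^sub>R integral\<^sup>L std_space g)"
    using s hG' by (subst lborel_has_bochner_integral_real_affine_iff[where c = s and t = 0])
      (auto simp: indicator_def cong: if_cong)
  moreover have "has_bochner_integral lborel (\<lambda>z. H ((z - s) / (1 - s))) ((1 - s) *\<^sub>R integral\<^sup>L std_space h)"
    using s hH by (subst lborel_has_bochner_integral_real_affine_iff[where c = "1 - s" and t = s])
      (auto cong: if_cong)
  ultimately have "has_bochner_integral lborel (\<lambda>z. indicator {..<s} z *\<^sub>R G (z / s) + H ((z - s) / (1 - s)))
      (s *\<^sub>R integral\<^sup>L std_space g + (1 - s) *\<^sub>R integral\<^sup>L std_space h)"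
    by (rule has_bochner_integral_add)
  also have "(\<lambda>z. indicator {..<s} z *\<^sub>R G (z / s) + H ((z - s) / (1 - s))) =
      (\<lambda>z. indicator {0..1} z *\<^sub>R glue s g h z)"
    using s by (intro ext) (auto simp: glue_def G_def H_def field_simps split: split_indicator)
  finally show ?thesis
    by (simp add: std_space_def has_bochner_integral_restrict_space)
qed

text \<open>The indicators of two exceptional null sets are glued. The resulting function has
  integral zero by \<open>nn_integral_glue\<close>, hence vanishes almost everywhere.\<close>

lemma AE_glue:
  assumes "AE z in std_space. P z" "AE z in std_space. Q z"
  shows "AE z in std_space. glue s P Q z"
proof -
  obtain A where A: "{z \<in> space std_space. \<not> P z} \<subseteq> A" "A \<in> sets std_space" "emeasure std_space A = 0"
    using assms(1) by (rule AE_E)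
  obtain B where B: "{z \<in> space std_space. \<not> Q z} \<subseteq> B" "B \<in> sets std_space" "emeasure std_space B = 0"
    using assms(2) by (rule AE_E)
  define N where "N = (glue s (indicator A) (indicator B) :: real \<Rightarrow> ennreal)"
  have "N \<in> borel_measurable std_space"
    unfolding N_def using A B by (intro measurable_glue) auto
  moreover have "(\<integral>\<^sup>+z. N z \<partial>std_space) = 0"
    unfolding N_def using A B by (subst nn_integral_glue) auto
  ultimately have "AE z in std_space. N z = 0"
    by (simp add: nn_integral_0_iff_AE)
  then show ?thesis
  proof (rule AE_mp, intro AE_I2 impI)
    fix z assume "z \<in> space std_space" "N z = 0"
    then have "if z < s then z / s \<notin> A else (z - s) / (1 - s) \<notin> B"
      by (auto simp: N_def glue_def indicator_eq_0_iff split: if_splits)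
    then show "glue s P Q z"
      using A(1) B(1) glue_arg[of z] \<open>z \<in> space std_space\<close>
      unfolding glue_def by (smt (verit) mem_Collect_eq space_std_space subsetD)
  qed
qed

end

section \<open>Finite algebras, their atoms and integrals of simple functions\<close>

lemma sets_sigma_finite_algebra:
  assumes "finite \<A>" "algebra \<Omega> \<A>"
  shows "sets (sigma \<Omega> \<A>) = \<A>"
  using assms by (intro sigma_algebra.sets_measure_of_eq algebra.is_sigma_algebra)

lemma atom_of_mem: "atom_of \<A> \<sigma> \<Longrightarrow> \<sigma> \<in> \<A>"
  by (simp add: atom_of_def)

lemma atom_of_subset:
  assumes "algebra \<Omega> \<A>" "atom_of \<A> \<sigma>" "B \<in> \<A>" "z \<in> \<sigma>" "z \<in> B"
  shows "\<sigma> \<subseteq> B"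
proof -
  interpret algebra \<Omega> \<A> by fact
  have minimal: "A = {} \<or> A = \<sigma>" if "A \<in> \<A>" "A \<subseteq> \<sigma>" for A
    using assms(2) that unfolding atom_of_def by simp
  have "\<sigma> \<in> \<A>" using assms(2) unfolding atom_of_def by simp
  then have "\<sigma> \<inter> B \<in> \<A>" using assms(3) by (rule Int)
  then have "\<sigma> \<inter> B = \<sigma>" using minimal[of "\<sigma> \<inter> B"] assms(4,5) by blast
  then show ?thesis by blast
qed

lemma ex_atom_of:
  assumes "finite \<A>" "algebra \<Omega> \<A>" "z \<in> \<Omega>"
  shows "\<exists>\<sigma>. atom_of \<A> \<sigma> \<and> z \<in> \<sigma>"
proof -
  interpret algebra \<Omega> \<A> by fact
  \<comment> \<open>The smallest member containing \<open>z\<close>; finiteness of the algebra keeps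
    this intersection inside it.\<close>
  define \<sigma> where "\<sigma> = \<Inter>{A \<in> \<A>. z \<in> A}"
  have \<sigma>: "\<sigma> \<in> \<A>"
  proof -
    have "finite {A \<in> \<A>. z \<in> A}" using assms(1) by simp
    moreover have "{A \<in> \<A>. z \<in> A} \<noteq> {}" using assms(3) top by blast
    ultimately have "(\<Inter>A\<in>{A \<in> \<A>. z \<in> A}. A) \<in> \<A>" by (rule finite_INT) blast
    then show ?thesis by (simp add: \<sigma>_def)
  qed
  moreover have "B = {} \<or> B = \<sigma>" if B: "B \<in> \<A>" "B \<subseteq> \<sigma>" for B
  proof (cases "z \<in> B")
    case True
    then show ?thesis using B by (auto simp: \<sigma>_def)
  next
    case False
    \<comment> \<open>If \<open>B\<close> misses \<open>z\<close>, then \<open>\<sigma> - B\<close>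
      is itself one of the intersected sets, so \<open>B\<close> must be empty.\<close>
    then have "\<sigma> \<subseteq> \<sigma> - B" if "z \<in> \<sigma>" using that B \<sigma> Diff[of \<sigma> B] unfolding \<sigma>_def by blast
    moreover have "z \<in> \<sigma>" by (simp add: \<sigma>_def)
    ultimately show ?thesis using B by blast
  qed
  moreover have "z \<in> \<sigma>" by (simp add: \<sigma>_def)
  ultimately show ?thesis unfolding atom_of_def by blast
qed

lemma set_integral_simple_function:
  fixes g :: "'c \<Rightarrow> 'b::{banach, second_countable_topology}"
  assumes "finite_measure P" "simple_function P X" "A \<in> sets P"
  shows "set_integrable P A (\<lambda>z. g (X z))"
    and "(LINT z:A|P. g (X z)) = (\<Sum>v\<in>X ` A. measure P (A \<inter> X -` {v}) *\<^sub>R g v)"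
proof -
  interpret finite_measure P by fact
  have fin: "finite (X ` A)"
    using assms sets.sets_into_space[OF assms(3)] by (auto simp: simple_function_def intro: finite_subset[OF image_mono])
  have meas: "A \<inter> X -` {v} \<in> sets P" for v
  proof -
    have "A \<inter> X -` {v} = A \<inter> (X -` {v} \<inter> space P)"
      using sets.sets_into_space[OF assms(3)] by auto
    then show ?thesis using simple_functionD(2)[OF assms(2)] assms(3) by simp
  qed
  have eq: "indicator A z *\<^sub>R g (X z) = (\<Sum>v\<in>X ` A. indicator (A \<inter> X -` {v}) z *\<^sub>R g v)" for z
  proof (cases "z \<in> A")
    case True
    then have "(\<Sum>v\<in>X ` A. indicator (A \<inter> X -` {v}) z *\<^sub>R g v) = (\<Sum>v\<in>X ` A. if v = X z then g v else 0)"
      by (intro sum.cong) auto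
    then show ?thesis using True fin by simp
  qed simp
  have int: "integrable P (\<lambda>z. indicator (A \<inter> X -` {v}) z *\<^sub>R g v)" for v
    using meas by (intro integrable_scaleR_left integrable_real_indicator) (auto simp: emeasure_eq_measure)
  show "set_integrable P A (\<lambda>z. g (X z))"
    unfolding set_integrable_def eq using int by (intro Bochner_Integration.integrable_sum)
  have int_ind: "integral\<^sup>L P (\<lambda>z. indicator (A \<inter> X -` {v}) z *\<^sub>R g v) = measure P (A \<inter> X -` {v}) *\<^sub>R g v" for v
    using meas[of v] sets.sets_into_space[OF meas[of v]]
    by (subst integral_scaleR_left) (auto simp: emeasure_eq_measure Int_absorb2)
  show "(LINT z:A|P. g (X z)) = (\<Sum>v\<in>X ` A. measure P (A \<inter> X -` {v}) *\<^sub>R g v)"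
    unfolding set_lebesgue_integral_def eq
    by (subst Bochner_Integration.integral_sum) (use int int_ind in auto)
qed

section \<open>Jensen's inequality along a martingale\<close>

locale w_martingale_space =
  fixes w :: "'a::euclidean_space set" and S M Minf
  assumes mart: "w_martingale w S M Minf"
begin

lemma
  shows finite_S: "finite (S n)"
    and algebra_S: "algebra {0..1} (S n)"
    and S_subset_sets: "S n \<subseteq> sets std_space"
    and S_Suc: "S n \<subseteq> S (Suc n)"
    and S_0: "S 0 = {{}, {0..1}}"
    and Minf_measurable: "Minf \<in> borel_measurable std_space"
    and Minf_fixed: "z \<in> {0..1} \<Longrightarrow> Minf z \<in> fixed_boundary w"
    and Minf_integrable: "integrable std_space Minf"
    and M_integrable: "integrable std_space (M n)"
    and M_cond_exp: "A \<in> S n \<Longrightarrow> (LINT z:A|std_space. M n z) = (LINT z:A|std_space. Minf z)"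
    and M_tendsto: "AE z in std_space. (\<lambda>n. M n z) \<longlonglongrightarrow> Minf z"
    and hull_step_subset: "atom_of (S n) \<sigma> \<Longrightarrow> convex hull (M n ` \<sigma> \<union> M (Suc n) ` \<sigma>) \<subseteq> w"
  using mart by (auto simp: w_martingale_def finite_filtration_def is_cond_exp_def)

lemma S_subset_Pow: "S n \<subseteq> Pow {0..1}"
  using algebra_S[of n] by (simp add: algebra_iff_Un)

lemma M_vimage: "B \<in> sets borel \<Longrightarrow> M n -` B \<inter> {0..1} \<in> S n"
  using mart measurable_sets[of "M n" "sigma {0..1} (S n)" borel B]
    sets_sigma_finite_algebra[OF finite_S algebra_S, of n] S_subset_Pow[of n]
  by (auto simp: w_martingale_def is_cond_exp_def space_measure_of)

text \<open>Level sets of \<open>M n\<close> belong to \<open>S n\<close>, and an atom lies inside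
  every member that it meets.\<close>

lemma M_const_on_atom:
  assumes "atom_of (S n) \<sigma>" "z \<in> \<sigma>" "z' \<in> \<sigma>"
  shows "M n z' = M n z"
proof -
  have "\<sigma> \<in> S n" using assms by (simp add: atom_of_def)
  then have "\<sigma> \<subseteq> {0..1}"
    using S_subset_Pow[of n] by blast
  then have "\<sigma> \<subseteq> M n -` {M n z} \<inter> {0..1}"
    using assms by (intro atom_of_subset[OF algebra_S assms(1) M_vimage assms(2)]) auto
  then show ?thesis using assms by auto
qed

lemma simple_function_M: "simple_function std_space (M n)"
  unfolding simple_function_def
proof
  \<comment> \<open>Distinct values have disjoint nonempty preimages in the finite family
    \<open>S n\<close>, so there are finitely many values.\<close>
  have "inj_on (\<lambda>v. M n -` {v} \<inter> {0..1}) (M n ` {0..1})"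
    by (auto simp: inj_on_def)
  moreover have "(\<lambda>v. M n -` {v} \<inter> {0..1}) ` (M n ` {0..1}) \<subseteq> S n"
    using M_vimage by auto
  ultimately show "finite (M n ` space std_space)"
    using finite_S inj_on_finite by (metis space_std_space)
  show "\<forall>v\<in>M n ` space std_space. M n -` {v} \<inter> space std_space \<in> sets std_space"
    using M_vimage[of "{_}" n] S_subset_sets by fastforce
qed

lemma M_in:
  assumes "z \<in> {0..1}" shows "M n z \<in> w"
proof -
  obtain \<sigma> where "atom_of (S n) \<sigma>" "z \<in> \<sigma>"
    using ex_atom_of[OF finite_S algebra_S assms] by blast
  then show ?thesis
    using hull_step_subset[of n \<sigma>] hull_inc[of "M n z"] by (metis UnCI image_eqI subsetD)
qed

lemma integrable_M:
  fixes h :: "'a \<Rightarrow> real"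
  shows "integrable std_space (\<lambda>z. h (M n z))"
proof -
  have "integrable std_space (\<lambda>z. indicator (space std_space) z *\<^sub>R h (M n z))"
    using set_integral_simple_function(1)[OF std.finite_measure_axioms simple_function_M sets.top]
    unfolding set_integrable_def .
  then show ?thesis
    by (rule Bochner_Integration.integrable_cong[THEN iffD1, rotated 2]) auto
qed

text \<open>On the atom, \<open>M n\<close> is a constant \<open>m\<close>, which is the barycentre
  of the values \<open>v\<close> of \<open>M (Suc n)\<close> with weights \<open>q v / p\<close>.
  Since \<open>w\<close> need not be convex, concavity is assumed on its convex subsets and applied
  to the hull that the martingale condition places in \<open>w\<close>.\<close>

lemma Jensen_atom:
  fixes h :: "'a \<Rightarrow> real"
  assumes h: "\<And>C. convex C \<Longrightarrow> C \<subseteq> w \<Longrightarrow> concave_on C h"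
    and \<sigma>: "atom_of (S n) \<sigma>"
  shows "(LINT z:\<sigma>|std_space. h (M (Suc n) z)) \<le> (LINT z:\<sigma>|std_space. h (M n z))"
proof -
  define X where "X = M (Suc n)"
  obtain z0 where z0: "z0 \<in> \<sigma>" using \<sigma> by (auto simp: atom_of_def)
  define m where "m = M n z0"
  have m: "M n z = m" if "z \<in> \<sigma>" for z
    using M_const_on_atom[OF \<sigma> z0 that] by (simp add: m_def)
  have \<sigma>S: "\<sigma> \<in> S n" using \<sigma> by (simp add: atom_of_def)
  then have \<sigma>sets: "\<sigma> \<in> sets std_space" using S_subset_sets by blast
  note sums = set_integral_simple_function(2)[OF std.finite_measure_axioms _ \<sigma>sets]
  have Mn: "(LINT z:\<sigma>|std_space. g (M n z)) = measure std_space \<sigma> *\<^sub>R g m"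
    for g :: "'a \<Rightarrow> 'c::{banach,second_countable_topology}"
  proof -
    have "M n ` \<sigma> = {m}" "\<sigma> \<inter> M n -` {m} = \<sigma>" using m z0 by auto
    then show ?thesis using sums[OF simple_function_M, of g n] by simp
  qed
  define p where "p = measure std_space \<sigma>"
  define q where "q v = measure std_space (\<sigma> \<inter> X -` {v})" for v
  have X: "(LINT z:\<sigma>|std_space. g (X z)) = (\<Sum>v\<in>X ` \<sigma>. q v *\<^sub>R g v)"
    for g :: "'a \<Rightarrow> 'c::{banach,second_countable_topology}"
    unfolding q_def X_def by (rule sums[OF simple_function_M])
  have q_le: "q v \<le> p" for v
    unfolding q_def p_def using \<sigma>sets by (intro std.finite_measure_mono) auto
  have q_nonneg: "0 \<le> q v" for v by (simp add: q_def)
  have "(\<Sum>v\<in>X ` \<sigma>. q v * h v) \<le> p * h m"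
  proof (cases "p = 0")
    case True
    \<comment> \<open>On a null atom the normalised weights are meaningless, but both sides of the
      inequality are zero.\<close>
    then have "q v = 0" for v using q_le[of v] q_nonneg[of v] by simp
    then show ?thesis using True by simp
  next
    case False
    then have p: "p > 0" by (simp add: p_def zero_less_measure_iff)
    have "X ` \<sigma> \<subseteq> X ` space std_space" using sets.sets_into_space[OF \<sigma>sets] by auto
    then have fin: "finite (X ` \<sigma>)"
      using simple_functionD(1)[OF simple_function_M, of "Suc n"] unfolding X_def by (rule finite_subset)
    have sum1: "(\<Sum>v\<in>X ` \<sigma>. q v / p) = 1"
    proof -
      have "(\<Sum>v\<in>X ` \<sigma>. q v) = (LINT z:\<sigma>|std_space. (1::real))"
        using X[of "\<lambda>_. 1::real"] by simp
      also have "\<dots> = p" using Mn[of "\<lambda>_. 1::real"] by (simp add: p_def)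
      finally show ?thesis using p by (simp flip: sum_divide_distrib)
    qed
    have "p *\<^sub>R m = (LINT z:\<sigma>|std_space. M n z)"
      using Mn[of "\<lambda>v. v"] by (simp add: p_def)
    also have "\<dots> = (LINT z:\<sigma>|std_space. X z)"
      \<comment> \<open>The atom lies in \<open>S n\<close> and in \<open>S (Suc n)\<close>, so both
        integrals equal that of \<open>Minf\<close>.\<close>
      unfolding X_def using \<sigma>S S_Suc by (subst (1 2) M_cond_exp) auto
    also have "\<dots> = (\<Sum>v\<in>X ` \<sigma>. q v *\<^sub>R v)" by (rule X)
    finally have "m = (1 / p) *\<^sub>R (\<Sum>v\<in>X ` \<sigma>. q v *\<^sub>R v)"
      using p by (metis divide_self_if less_irrefl scaleR_one scaleR_scaleR times_divide_eq_left mult_1)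
    then have summ: "(\<Sum>v\<in>X ` \<sigma>. (q v / p) *\<^sub>R v) = m"
      by (simp add: scaleR_sum_right)
    have "convex_on (convex hull (M n ` \<sigma> \<union> X ` \<sigma>)) (\<lambda>v. - h v)"
      using h[OF convex_convex_hull hull_step_subset[OF \<sigma>]] by (simp add: concave_on_def X_def)
    then have "- h (\<Sum>v\<in>X ` \<sigma>. (q v / p) *\<^sub>R v) \<le> (\<Sum>v\<in>X ` \<sigma>. (q v / p) * - h v)"
      using fin z0 sum1 p q_nonneg by (intro convex_on_sum[where C = "convex hull (M n ` \<sigma> \<union> X ` \<sigma>)"])
        (auto intro: hull_inc)
    then have "(\<Sum>v\<in>X ` \<sigma>. q v * h v) / p \<le> h m"
      by (simp add: summ sum_negf sum_divide_distrib)
    then show ?thesis using p by (simp add: field_simps)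
  qed
  then show ?thesis
    using Mn[of h] X[of h] by (simp add: X_def p_def)
qed

lemma supermartingale:
  fixes h :: "'a \<Rightarrow> real"
  assumes h: "\<And>C. convex C \<Longrightarrow> C \<subseteq> w \<Longrightarrow> concave_on C h"
    and start: "starts_at M x"
  shows "(\<integral>z. h (M n z) \<partial>std_space) \<le> h x"
proof (induction n)
  case 0
  have "(\<integral>z. h (M 0 z) \<partial>std_space) = (\<integral>z. h x \<partial>std_space)"
    using start by (intro Bochner_Integration.integral_cong) (auto simp: starts_at_def)
  then show ?case by (simp add: std.prob_space[simplified])
next
  case (Suc n)
  \<comment> \<open>The atoms partition the unit interval into finitely many measurable sets, so the
    inequality on each atom can be summed.\<close>
  define \<T> where "\<T> = {\<sigma>. atom_of (S n) \<sigma>}"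
  have \<T>: "\<T> \<subseteq> S n" by (auto simp: \<T>_def atom_of_def)
  have sets: "\<sigma> \<in> sets std_space" if "\<sigma> \<in> \<T>" for \<sigma> using that \<T> S_subset_sets by blast
  have "finite \<T>" using \<T> finite_S by (rule finite_subset)
  have "\<Union>\<T> = space std_space"
    using ex_atom_of[OF finite_S algebra_S, of _ n] \<T> S_subset_Pow[of n]
    by (auto simp: \<T>_def)
  have disj: "disjoint_family_on (\<lambda>\<sigma>. \<sigma>) \<T>"
    unfolding disjoint_family_on_def
  proof (intro ballI impI)
    fix \<sigma> \<tau> assume *: "\<sigma> \<in> \<T>" "\<tau> \<in> \<T>" "\<sigma> \<noteq> \<tau>"
    then have "\<sigma> \<subseteq> \<tau>" "\<tau> \<subseteq> \<sigma>" if "z \<in> \<sigma>" "z \<in> \<tau>" for z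
      using that atom_of_subset[OF algebra_S, of n \<sigma> \<tau> z] atom_of_subset[OF algebra_S, of n \<tau> \<sigma> z] \<T>
      unfolding \<T>_def by blast+
    then show "\<sigma> \<inter> \<tau> = {}" using * by blast
  qed
  have split: "(\<integral>z. h (M k z) \<partial>std_space) = (\<Sum>\<sigma>\<in>\<T>. LINT z:\<sigma>|std_space. h (M k z))" for k
  proof -
    have "(\<integral>z. h (M k z) \<partial>std_space) = (LINT z:\<Union>\<T>|std_space. h (M k z))"
      unfolding \<open>\<Union>\<T> = space std_space\<close> set_lebesgue_integral_def
      by (rule Bochner_Integration.integral_cong) auto
    also have "\<dots> = (\<Sum>\<sigma>\<in>\<T>. LINT z:\<sigma>|std_space. h (M k z))"
      using set_integral_finite_Union[OF \<open>finite \<T>\<close> disj, of std_space "\<lambda>z. h (M k z)"] sets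
        set_integral_simple_function(1)[OF std.finite_measure_axioms simple_function_M, where g = h]
      by simp
    finally show ?thesis .
  qed
  have "(\<integral>z. h (M (Suc n) z) \<partial>std_space) \<le> (\<integral>z. h (M n z) \<partial>std_space)"
    unfolding split using Jensen_atom[OF h] by (intro sum_mono) (auto simp: \<T>_def)
  then show ?case using Suc by simp
qed

end

section \<open>Concatenation of two martingales\<close>

lemma glue_apply: "k (glue s g h z) = glue s (\<lambda>u. k (g u)) (\<lambda>u. k (h u)) z"
  by (simp add: glue_def)

text \<open>A copy of \<open>A\<close> scaled into [0, s) joined with a copy of \<open>B\<close>
  scaled into [s, 1]. Using \<open>glue\<close> on truth values makes unions and complements act on
  the two components separately.\<close>

definition glue_set :: "real \<Rightarrow> real set \<Rightarrow> real set \<Rightarrow> real set" where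
  "glue_set s A B = {z \<in> {0..1}. glue s (\<lambda>u. u \<in> A) (\<lambda>u. u \<in> B) z}"

text \<open>Time is delayed by one: the filtration must start trivially, and the first step only
  reveals which of the two pieces contains the sample point.\<close>

definition glue_algebra :: "real \<Rightarrow> (nat \<Rightarrow> real set set) \<Rightarrow> (nat \<Rightarrow> real set set) \<Rightarrow> nat \<Rightarrow> real set set" where
  "glue_algebra s S T n =
    (case n of 0 \<Rightarrow> {{}, {0..1}} | Suc k \<Rightarrow> {glue_set s A B | A B. A \<in> S k \<and> B \<in> T k})"

definition glue_process ::
    "real \<Rightarrow> 'b \<Rightarrow> (nat \<Rightarrow> real \<Rightarrow> 'b) \<Rightarrow> (nat \<Rightarrow> real \<Rightarrow> 'b) \<Rightarrow> nat \<Rightarrow> real \<Rightarrow> 'b" where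
  "glue_process s x M N n = (case n of 0 \<Rightarrow> \<lambda>_. x | Suc k \<Rightarrow> glue s (M k) (N k))"

context
  fixes s :: real
  assumes s: "0 < s" "s < 1"
begin

lemma glue_set_in_sets:
  assumes "A \<in> sets std_space" "B \<in> sets std_space"
  shows "glue_set s A B \<in> sets std_space"
proof -
  have "glue s (\<lambda>u. u \<in> A) (\<lambda>u. u \<in> B) \<in> measurable std_space (count_space UNIV)"
    using assms by (intro measurable_glue[OF s] pred_sets2[OF _ measurable_ident_sets]) auto
  then show ?thesis
    unfolding pred_def by (simp add: glue_set_def)
qed

lemma glue_set_Un: "glue_set s A B \<union> glue_set s A' B' = glue_set s (A \<union> A') (B \<union> B')"
  by (auto simp: glue_set_def glue_def)

lemma glue_set_empty: "glue_set s {} {} = {}"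
  by (auto simp: glue_set_def glue_def)

lemma glue_set_Diff: "{0..1} - glue_set s A B = glue_set s ({0..1} - A) ({0..1} - B)"
  using glue_arg[OF s] by (auto simp: glue_set_def glue_def split: if_splits)

lemma glue_set_space: "glue_set s {0..1} {0..1} = {0..1}"
  using glue_set_Diff[of "{}" "{}"] by (simp add: glue_set_empty)

lemma set_integral_glue:
  fixes g h :: "real \<Rightarrow> 'b::euclidean_space"
  assumes "integrable std_space g" "integrable std_space h" "A \<in> sets std_space" "B \<in> sets std_space"
  shows "(LINT z:glue_set s A B|std_space. glue s g h z) =
    s *\<^sub>R (LINT z:A|std_space. g z) + (1 - s) *\<^sub>R (LINT z:B|std_space. h z)"
proof -
  have "(LINT z:glue_set s A B|std_space. glue s g h z) =
      (\<integral>z. glue s (\<lambda>u. indicator A u *\<^sub>R g u) (\<lambda>u. indicator B u *\<^sub>R h u) z \<partial>std_space)"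
    unfolding set_lebesgue_integral_def
    by (rule Bochner_Integration.integral_cong) (auto simp: glue_set_def glue_def split: split_indicator)
  also have "\<dots> = s *\<^sub>R (\<integral>z. indicator A z *\<^sub>R g z \<partial>std_space) + (1 - s) *\<^sub>R (\<integral>z. indicator B z *\<^sub>R h z \<partial>std_space)"
    using assms by (intro has_bochner_integral_integral_eq has_bochner_integral_glue[OF s] integrable_mult_indicator)
  finally show ?thesis by (simp add: set_lebesgue_integral_def)
qed

text \<open>The first step leads from \<open>x\<close> to \<open>a\<close> with probability
  \<open>s\<close> and to \<open>b\<close> with probability \<open>1 - s\<close>; it stays in the
  segment, which lies in \<open>w\<close>. From then on each atom sits inside a rescaled atom of one
  of the two filtrations and inherits its hull condition.\<close>

lemma w_martingale_glue:
  fixes w :: "'a::euclidean_space set"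
  assumes "w_martingale w S M I" "starts_at M a" "w_martingale w T N J" "starts_at N b"
    and seg: "closed_segment a b \<subseteq> w"
  defines "x \<equiv> s *\<^sub>R a + (1 - s) *\<^sub>R b"
  shows "w_martingale w (glue_algebra s S T) (glue_process s x M N) (glue s I J)"
    and "starts_at (glue_process s x M N) x"
proof -
  interpret A: w_martingale_space w S M I by standard fact
  interpret B: w_martingale_space w T N J by standard fact
  let ?R = "glue_algebra s S T" and ?L = "glue_process s x M N" and ?K = "glue s I J"
  have R_0: "?R 0 = {{}, {0..1}}" and R_Suc: "?R (Suc k) = {glue_set s A B | A B. A \<in> S k \<and> B \<in> T k}" for k
    by (simp_all add: glue_algebra_def)
  have L_0: "?L 0 = (\<lambda>_. x)" and L_Suc: "?L (Suc k) = glue s (M k) (N k)" for k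
    by (simp_all add: glue_process_def)
  have emp: "{} \<in> S k" "{0..1} \<in> S k" "{} \<in> T k" "{0..1} \<in> T k" for k
    using A.algebra_S[of k] B.algebra_S[of k] unfolding algebra_iff_Un by auto
  have alg: "algebra {0..1} (?R n)" for n
  proof (cases n)
    case 0
    then show ?thesis by (auto simp: R_0 algebra_iff_Un)
  next
    case (Suc k)
    have a: "C \<in> S k \<Longrightarrow> {0..1} - C \<in> S k" "C \<in> S k \<Longrightarrow> C' \<in> S k \<Longrightarrow> C \<union> C' \<in> S k"
         "C \<in> T k \<Longrightarrow> {0..1} - C \<in> T k" "C \<in> T k \<Longrightarrow> C' \<in> T k \<Longrightarrow> C \<union> C' \<in> T k" for C C'
      using A.algebra_S[of k] B.algebra_S[of k] unfolding algebra_iff_Un by auto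
    show ?thesis
      unfolding algebra_iff_Un Suc R_Suc
    proof (intro conjI ballI)
      show "{glue_set s A B |A B. A \<in> S k \<and> B \<in> T k} \<subseteq> Pow {0..1}"
        by (auto simp: glue_set_def)
      show "{} \<in> {glue_set s A B |A B. A \<in> S k \<and> B \<in> T k}"
        using emp glue_set_empty by blast
    next
      fix C assume "C \<in> {glue_set s A B |A B. A \<in> S k \<and> B \<in> T k}"
      then show "{0..1} - C \<in> {glue_set s A B |A B. A \<in> S k \<and> B \<in> T k}"
        using glue_set_Diff a by blast
    next
      fix C D assume "C \<in> {glue_set s A B |A B. A \<in> S k \<and> B \<in> T k}"
        "D \<in> {glue_set s A B |A B. A \<in> S k \<and> B \<in> T k}"
      then show "C \<union> D \<in> {glue_set s A B |A B. A \<in> S k \<and> B \<in> T k}"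
        using glue_set_Un a by blast
    qed
  qed
  have fin: "finite (?R n)" for n
  proof (cases n)
    case (Suc k)
    have "?R n = (\<lambda>(A, B). glue_set s A B) ` (S k \<times> T k)" by (auto simp: Suc R_Suc)
    then show ?thesis using A.finite_S B.finite_S by simp
  qed (simp add: R_0)
  have sub: "?R n \<subseteq> sets std_space" for n
  proof (cases n)
    case 0
    then show ?thesis using sets.top[of std_space] by (simp add: R_0)
  next
    case (Suc k)
    then show ?thesis using A.S_subset_sets B.S_subset_sets
      by (auto simp: R_Suc intro!: glue_set_in_sets)
  qed
  have mono: "?R n \<subseteq> ?R (Suc n)" for n
  proof (cases n)
    case 0
    have "glue_set s {} {} \<in> ?R (Suc n)" "glue_set s {0..1} {0..1} \<in> ?R (Suc n)"
      using emp unfolding R_Suc by blast+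
    then show ?thesis by (auto simp: 0 R_0 glue_set_empty glue_set_space)
  next
    case (Suc k)
    then show ?thesis using A.S_Suc[of k] B.S_Suc[of k] by (auto simp: R_Suc)
  qed
  have Kmeas: "?K \<in> borel_measurable std_space"
    using A.Minf_measurable B.Minf_measurable by (rule measurable_glue[OF s])
  have Kint: "integrable std_space ?K"
    using has_bochner_integral_glue[OF s A.Minf_integrable B.Minf_integrable]
    by (simp add: has_bochner_integral_iff)
  have Kfix: "?K z \<in> fixed_boundary w" if "z \<in> {0..1}" for z
    using glue_arg[OF s, of z] A.Minf_fixed B.Minf_fixed that by (auto simp: glue_def)
  have Mstart: "M 0 z = a" "N 0 z = b" if "z \<in> {0..1}" for z
    using assms(2,4) that by (auto simp: starts_at_def)
  \<comment> \<open>The constant starting values are the means of the terminal values, by the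
    conditional expectation property on the whole space at time 0.\<close>
  have int_start: "(LINT z:{0..1}|std_space. I z) = a" "(LINT z:{0..1}|std_space. J z) = b"
  proof -
    have const: "(LINT z:{0..1}|std_space. X z) = c" if "\<And>z. z \<in> {0..1} \<Longrightarrow> X z = c" for X and c :: 'a
    proof -
      have "(LINT z:{0..1}|std_space. X z) = (\<integral>z. c \<partial>std_space)"
        unfolding set_lebesgue_integral_def
        by (rule Bochner_Integration.integral_cong) (auto simp: that)
      then show ?thesis by (simp add: std.prob_space[simplified])
    qed
    show "(LINT z:{0..1}|std_space. I z) = a" "(LINT z:{0..1}|std_space. J z) = b"
      using const[of "M 0" a] const[of "N 0" b] Mstart A.M_cond_exp[of "{0..1}" 0] B.M_cond_exp[of "{0..1}" 0] emp
      by auto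
  qed
  have cond: "is_cond_exp std_space (?R n) ?K (?L n)" for n
  proof (cases n)
    case 0
    have "(LINT z:{0..1}|std_space. ?K z) = x"
      using set_integral_glue[OF A.Minf_integrable B.Minf_integrable, of "{0..1}" "{0..1}"] sets.top[of std_space]
      by (simp add: glue_set_space int_start x_def)
    moreover have "(LINT z:{0..1}|std_space. x) = x"
      unfolding set_lebesgue_integral_def
      using Bochner_Integration.integral_cong[of std_space std_space "\<lambda>z. indicator {0..1} z *\<^sub>R x" "\<lambda>_. x"]
      by (simp add: std.prob_space[simplified])
    ultimately show ?thesis
      by (auto simp: 0 R_0 L_0 is_cond_exp_def set_lebesgue_integral_def)
  next
    case (Suc k)
    have sets_R: "sets (sigma {0..1} (?R n)) = ?R n"
      by (rule sets_sigma_finite_algebra[OF fin alg])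
    have "?L n \<in> borel_measurable (sigma {0..1} (?R n))"
    proof (rule measurableI)
      fix B :: "'a set" assume B: "B \<in> sets borel"
      have "?L n -` B \<inter> {0..1} = glue_set s (M k -` B \<inter> {0..1}) (N k -` B \<inter> {0..1})"
      proof (rule set_eqI)
        fix z show "z \<in> ?L n -` B \<inter> {0..1} \<longleftrightarrow> z \<in> glue_set s (M k -` B \<inter> {0..1}) (N k -` B \<inter> {0..1})"
          using glue_arg[OF s, of z] by (cases "z < s") (auto simp: Suc L_Suc glue_set_def glue_def)
      qed
      then have "?L n -` B \<inter> {0..1} \<in> ?R n"
        using A.M_vimage[OF B, of k] B.M_vimage[OF B, of k] unfolding Suc R_Suc by blast
      then show "?L n -` B \<inter> space (sigma {0..1} (?R n)) \<in> sets (sigma {0..1} (?R n))"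
        unfolding sets_R by (simp add: space_measure_of_conv)
    qed simp
    moreover have "integrable std_space (?L n)"
      using has_bochner_integral_glue[OF s A.M_integrable B.M_integrable, of k k]
      by (simp add: has_bochner_integral_iff Suc L_Suc)
    moreover have "(LINT z:C|std_space. ?L n z) = (LINT z:C|std_space. ?K z)" if "C \<in> ?R n" for C
    proof -
      obtain A B where C: "C = glue_set s A B" and AB: "A \<in> S k" "B \<in> T k"
        using \<open>C \<in> ?R n\<close> unfolding Suc R_Suc by blast
      then have "A \<in> sets std_space" "B \<in> sets std_space"
        using A.S_subset_sets B.S_subset_sets by blast+
      then show ?thesis
        using AB A.M_cond_exp[of A k] B.M_cond_exp[of B k]
        by (simp add: C Suc L_Suc set_integral_glue A.M_integrable B.M_integrable A.Minf_integrable B.Minf_integrable)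
    qed
    ultimately show ?thesis by (simp add: is_cond_exp_def)
  qed
  have "AE z in std_space. glue s (\<lambda>u. (\<lambda>n. M n u) \<longlonglongrightarrow> I u) (\<lambda>u. (\<lambda>n. N n u) \<longlonglongrightarrow> J u) z"
    by (rule AE_glue[OF s A.M_tendsto B.M_tendsto])
  then have lim: "AE z in std_space. (\<lambda>n. ?L n z) \<longlonglongrightarrow> ?K z"
  proof (rule AE_mp, intro AE_I2 impI)
    fix z assume "glue s (\<lambda>u. (\<lambda>n. M n u) \<longlonglongrightarrow> I u) (\<lambda>u. (\<lambda>n. N n u) \<longlonglongrightarrow> J u) z"
    then have "(\<lambda>n. ?L (Suc n) z) \<longlonglongrightarrow> ?K z"
      by (simp add: L_Suc glue_def split: if_splits)
    then show "(\<lambda>n. ?L n z) \<longlonglongrightarrow> ?K z"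
      by (rule LIMSEQ_imp_Suc)
  qed
  have hull: "convex hull (?L n ` \<sigma> \<union> ?L (Suc n) ` \<sigma>) \<subseteq> w" if \<sigma>: "atom_of (?R n) \<sigma>" for n \<sigma>
  proof -
    have "\<sigma> \<in> ?R n" and "\<sigma> \<noteq> {}" using \<sigma> by (simp_all add: atom_of_def)
    then have \<sigma>_sub: "\<sigma> \<subseteq> {0..1}" using sub[of n] sets.sets_into_space[of \<sigma> std_space] by auto
    obtain z where z: "z \<in> \<sigma>" "z \<in> {0..1}" using \<open>\<sigma> \<noteq> {}\<close> \<sigma>_sub by blast
    show ?thesis
    proof (cases n)
      case 0
      have "x \<in> closed_segment a b"
        using s unfolding x_def closed_segment_def
        by (auto intro!: exI[of _ "1 - s"])
      moreover have "glue s (M 0) (N 0) u \<in> {a, b}" if "u \<in> \<sigma>" for u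
        using glue_arg[OF s, of u] that \<sigma>_sub Mstart by (auto simp: glue_def)
      ultimately have "?L n ` \<sigma> \<union> ?L (Suc n) ` \<sigma> \<subseteq> closed_segment a b"
        by (auto simp: 0 L_0 L_Suc)
      then have "convex hull (?L n ` \<sigma> \<union> ?L (Suc n) ` \<sigma>) \<subseteq> closed_segment a b"
        by (intro hull_minimal) auto
      then show ?thesis using seg by blast
    next
      case (Suc k)
      show ?thesis
      proof (cases "z < s")
        case True
        obtain \<alpha> where \<alpha>: "atom_of (S k) \<alpha>" "z / s \<in> \<alpha>" "\<alpha> \<in> S k"
          using ex_atom_of[OF A.finite_S A.algebra_S glue_arg(1)[OF s z(2) True]] atom_of_mem by blast
        \<comment> \<open>Pairing \<open>\<alpha>\<close> with the empty set gives a member of the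
          glued algebra inside the first piece. The atom \<open>\<sigma>\<close> meets it at
          \<open>z\<close>, hence cannot reach the second piece.\<close>
        have "\<sigma> \<subseteq> glue_set s \<alpha> {}"
        proof (rule atom_of_subset[OF alg \<sigma> _ z(1)])
          show "glue_set s \<alpha> {} \<in> ?R n" using \<alpha>(3) emp unfolding Suc R_Suc by blast
          show "z \<in> glue_set s \<alpha> {}" using z \<alpha> True by (simp add: glue_set_def glue_def)
        qed
        then have "?L n ` \<sigma> \<union> ?L (Suc n) ` \<sigma> \<subseteq> M k ` \<alpha> \<union> M (Suc k) ` \<alpha>"
          by (auto simp: Suc L_Suc glue_set_def glue_def split: if_splits)
        then show ?thesis using A.hull_step_subset[OF \<alpha>(1)] hull_mono by blast
      next
        case False
        obtain \<beta> where \<beta>: "atom_of (T k) \<beta>" "(z - s) / (1 - s) \<in> \<beta>" "\<beta> \<in> T k"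
          using ex_atom_of[OF B.finite_S B.algebra_S glue_arg(2)[OF s z(2) False]] atom_of_mem by blast
        have "\<sigma> \<subseteq> glue_set s {} \<beta>"
        proof (rule atom_of_subset[OF alg \<sigma> _ z(1)])
          show "glue_set s {} \<beta> \<in> ?R n" using \<beta>(3) emp unfolding Suc R_Suc by blast
          show "z \<in> glue_set s {} \<beta>" using z \<beta> False by (simp add: glue_set_def glue_def)
        qed
        then have "?L n ` \<sigma> \<union> ?L (Suc n) ` \<sigma> \<subseteq> N k ` \<beta> \<union> N (Suc k) ` \<beta>"
          by (auto simp: Suc L_Suc glue_set_def glue_def split: if_splits)
        then show ?thesis using B.hull_step_subset[OF \<beta>(1)] hull_mono by blast
      qed
    qed
  qed
  show "w_martingale w ?R ?L ?K"
    unfolding w_martingale_def finite_filtration_def space_std_space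
    by (intro conjI allI ballI impI alg fin sub mono R_0 Kmeas Kfix Kint cond lim hull)
  show "starts_at ?L x"
    by (simp add: starts_at_def L_0)
qed

end

text \<open>Shifting by a lower bound reduces the integral of an unbounded function to a single
  nonnegative one.\<close>

lemma ext_integral_shift:
  assumes "prob_space P" and g: "g \<in> borel_measurable P"
    and c: "c \<le> 0" "\<And>z. z \<in> space P \<Longrightarrow> c \<le> g z"
  shows "ext_integral P g = enn2ereal (\<integral>\<^sup>+z. ennreal (g z - c) \<partial>P) + ereal c"
proof -
  interpret prob_space P by fact
  note [measurable] = g
  have "(\<integral>\<^sup>+z. ennreal (- g z) \<partial>P) \<le> (\<integral>\<^sup>+z. ennreal (- c) \<partial>P)"
    using c by (intro nn_integral_mono ennreal_leI) auto
  also have "\<dots> < \<infinity>" using emeasure_space_1 by (simp add: ennreal_mult_less_top)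
  finally obtain N where N: "(\<integral>\<^sup>+z. ennreal (- g z) \<partial>P) = ennreal N" "0 \<le> N"
    by (cases "\<integral>\<^sup>+z. ennreal (- g z) \<partial>P") auto
  have "(\<integral>\<^sup>+z. ennreal (g z - c) \<partial>P) + ennreal N = (\<integral>\<^sup>+z. ennreal (g z - c) + ennreal (- g z) \<partial>P)"
    unfolding N(1)[symmetric] by (subst nn_integral_add) auto
  also have "\<dots> = (\<integral>\<^sup>+z. ennreal (g z) + ennreal (- c) \<partial>P)"
  proof (intro nn_integral_cong)
    fix z assume "z \<in> space P"
    \<comment> \<open>All four terms are nonnegative, so the identity can be integrated without
      subtraction; finiteness of \<open>N\<close> permits the rearrangement afterwards.\<close>
    then show "ennreal (g z - c) + ennreal (- g z) = ennreal (g z) + ennreal (- c)"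
      using c by (cases "0 \<le> g z") (auto simp: ennreal_neg simp flip: ennreal_plus)
  qed
  also have "\<dots> = (\<integral>\<^sup>+z. ennreal (g z) \<partial>P) + ennreal (- c)"
    using emeasure_space_1 by (subst nn_integral_add) auto
  finally have "enn2ereal (\<integral>\<^sup>+z. ennreal (g z - c) \<partial>P) + ereal N =
      enn2ereal (\<integral>\<^sup>+z. ennreal (g z) \<partial>P) + ereal (- c)"
    using N(2) c(1) by (metis enn2ereal_ennreal neg_0_le_iff_le plus_ennreal.rep_eq)
  then show ?thesis
    unfolding ext_integral_def N(1) using N(2)
    by (cases "enn2ereal (\<integral>\<^sup>+z. ennreal (g z - c) \<partial>P)"; cases "enn2ereal (\<integral>\<^sup>+z. ennreal (g z) \<partial>P)")
       (auto simp: enn2ereal_ennreal)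
qed

section \<open>Truncated majorants\<close>

text \<open>The minimum of a concave function and a constant is concave. As \<open>G\<close> avoids
  -infinity on \<open>w\<close>, the minimum is finite there, so \<open>real_of_ereal\<close> never
  returns its default value at an infinity.\<close>

lemma concave_on_min_locally_concave:
  assumes G: "locally_concave_on w G" "\<And>x. x \<in> w \<Longrightarrow> G x \<noteq> -\<infinity>" and C: "convex C" "C \<subseteq> w"
  shows "concave_on C (\<lambda>x. real_of_ereal (min (G x) (ereal K)))"
  unfolding concave_on_iff
proof (intro conjI ballI allI impI C(1))
  fix x y :: 'a and u v :: real
  assume xy: "x \<in> C" "y \<in> C" and uv: "0 \<le> u" "0 \<le> v" "u + v = 1"
  have seg: "closed_segment x y \<subseteq> C" using xy C(1) by (simp add: closed_segment_subset)
  have z: "u *\<^sub>R x + v *\<^sub>R y \<in> C" using C(1) xy uv by (simp add: convexD)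
  have u: "u = 1 - v" "v \<in> {0..1}" using uv by auto
  have "ext_concave_on (closed_segment x y) G"
    using G(1) seg C(2) unfolding locally_concave_on_def by blast
  then have *: "ereal u * G x + ereal v * G y \<le> G (u *\<^sub>R x + v *\<^sub>R y)"
    using u unfolding ext_concave_on_def by auto
  have ninf: "G x \<noteq> -\<infinity>" "G y \<noteq> -\<infinity>" "G (u *\<^sub>R x + v *\<^sub>R y) \<noteq> -\<infinity>"
    using G(2) C(2) xy z by auto
  define a b c where "a = real_of_ereal (min (G x) (ereal K))" and "b = real_of_ereal (min (G y) (ereal K))"
    and "c = real_of_ereal (min (G (u *\<^sub>R x + v *\<^sub>R y)) (ereal K))"
  have a: "ereal a \<le> G x" "a \<le> K" and b: "ereal b \<le> G y" "b \<le> K"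
    using ninf by (cases "G x"; cases "G y"; simp add: a_def b_def min_def)+
  have "ereal (u * a + v * b) \<le> ereal u * G x + ereal v * G y"
    using uv a b by (auto simp flip: plus_ereal.simps(1) times_ereal.simps(1)
        intro!: add_mono ereal_mult_left_mono)
  then have "ereal (u * a + v * b) \<le> G (u *\<^sub>R x + v *\<^sub>R y)" using * by (rule order_trans)
  moreover have "u * a + v * b \<le> K" using convex_bound_le[of a K b u v] a b uv by simp
  ultimately show "u * a + v * b \<le> c"
    using ninf(3) by (cases "G (u *\<^sub>R x + v *\<^sub>R y)") (auto simp: c_def min_def)
qed

lemma fixed_boundary_subset:
  assumes "closed w"
  shows "fixed_boundary w \<subseteq> w"
  using assms frontier_subset_closed by (auto simp: fixed_boundary_def)

section \<open>The martingale Bellman function lies below the minimal majorant\<close>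

context
  fixes w :: "'a::euclidean_space set" and f :: "'a \<Rightarrow> real" and c :: real
  assumes closed_w: "closed w"
    and connected: "strongly_martingale_connected w"
    and f_meas: "f \<in> borel_measurable (restrict_space borel (fixed_boundary w))"
    and c: "c \<le> 0" "\<And>x. x \<in> fixed_boundary w \<Longrightarrow> c \<le> f x"
begin

text \<open>Truncating \<open>G\<close> at level \<open>c\<close> makes its terminal value under a simple martingale
  identically \<open>c\<close>.\<close>

lemma concave_majorant_ge:
  assumes G: "G \<in> concave_majorants w f" and x: "x \<in> w"
  shows "ereal c \<le> G x"
proof -
  obtain S M I n where "w_martingale w S M I" and start: "starts_at M x"
    and simple: "AE z in std_space. M n z = I z"
    using connected x unfolding strongly_martingale_connected_def simple_w_martingale_def by blast
  interpret w_martingale_space w S M I by standard fact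
  define h where "h = (\<lambda>x. real_of_ereal (min (G x) (ereal c)))"
  have Gninf: "G y \<noteq> -\<infinity>" if "y \<in> w" for y using G that by (auto simp: concave_majorants_def)
  have "AE z in std_space. h (M n z) = c"
    using simple
  proof (rule AE_mp, intro AE_I2 impI)
    fix z assume z: "z \<in> space std_space" "M n z = I z"
    then have "I z \<in> fixed_boundary w" using Minf_fixed by simp
    then have "ereal c \<le> G (I z)"
      using c(2)[of "I z"] G order_trans[of "ereal c" "ereal (f (I z))"] by (simp add: concave_majorants_def)
    then show "h (M n z) = c" by (simp add: h_def z min_def)
  qed
  then have "(\<integral>z. h (M n z) \<partial>std_space) = (\<integral>z. c \<partial>std_space)"
    by (intro integral_cong_AE borel_measurable_integrable integrable_M) auto
  then have "c = (\<integral>z. h (M n z) \<partial>std_space)"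
    by (simp add: std.prob_space[simplified])
  also have "\<dots> \<le> h x"
    unfolding h_def using G Gninf
    by (intro supermartingale concave_on_min_locally_concave start) (auto simp: concave_majorants_def)
  finally show ?thesis
    using Gninf[OF x] by (cases "G x") (auto simp: h_def min_def split: if_splits)
qed

lemma minimal_concave_ge:
  assumes "x \<in> w" shows "ereal c \<le> minimal_concave w f x"
  unfolding minimal_concave_def using concave_majorant_ge assms by (intro INF_greatest)

text \<open>Concavity along a segment survives a pointwise infimum; the common lower bound
  \<open>c\<close> excludes the value -infinity.\<close>

lemma minimal_concave_in_majorants: "minimal_concave w f \<in> concave_majorants w f"
  unfolding concave_majorants_def
proof (intro CollectI conjI ballI)
  fix x assume "x \<in> w"
  then show "minimal_concave w f x \<noteq> -\<infinity>" using minimal_concave_ge[of x] by auto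
next
  fix x assume "x \<in> fixed_boundary w"
  then show "ereal (f x) \<le> minimal_concave w f x"
    unfolding minimal_concave_def by (intro INF_greatest) (auto simp: concave_majorants_def)
next
  show "locally_concave_on w (minimal_concave w f)"
    unfolding locally_concave_on_def ext_concave_on_def
  proof (intro allI impI conjI ballI)
    fix a b :: 'a assume seg: "closed_segment a b \<subseteq> w"
    show "convex (closed_segment a b)" by simp
    fix x assume x: "x \<in> closed_segment a b"
    then show "minimal_concave w f x \<noteq> -\<infinity>" using minimal_concave_ge[of x] seg by auto
    fix y and t :: real assume y: "y \<in> closed_segment a b" and t: "t \<in> {0..1}"
    show "ereal (1 - t) * minimal_concave w f x + ereal t * minimal_concave w f y
        \<le> minimal_concave w f ((1 - t) *\<^sub>R x + t *\<^sub>R y)" (is "?L \<le> minimal_concave w f ?z")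
      unfolding minimal_concave_def[of w f ?z]
    proof (intro INF_greatest)
      fix G assume G: "G \<in> concave_majorants w f"
      then have "minimal_concave w f x \<le> G x" "minimal_concave w f y \<le> G y"
        unfolding minimal_concave_def by (auto intro: INF_lower)
      then have "?L \<le> ereal (1 - t) * G x + ereal t * G y"
        using t by (intro add_mono ereal_mult_left_mono) auto
      also have "\<dots> \<le> G ?z"
        using G seg x y t unfolding concave_majorants_def locally_concave_on_def ext_concave_on_def by blast
      finally show "?L \<le> G ?z" .
    qed
  qed
qed

lemma measurable_f_terminal:
  assumes "w_martingale w S M I"
  shows "(\<lambda>z. f (I z)) \<in> borel_measurable std_space"
proof -
  interpret w_martingale_space w S M I by standard fact
  have "I \<in> measurable std_space (restrict_space borel (fixed_boundary w))"
    using Minf_measurable Minf_fixed by (intro measurable_restrict_space2) auto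
  then show ?thesis using f_meas by (rule measurable_compose)
qed

lemma ext_integral_terminal:
  assumes "w_martingale w S M I"
  shows "ext_integral std_space (\<lambda>z. f (I z)) =
    enn2ereal (\<integral>\<^sup>+z. ennreal (f (I z) - c) \<partial>std_space) + ereal c"
proof -
  interpret w_martingale_space w S M I by standard fact
  show ?thesis
    using c(2)[OF Minf_fixed]
    by (intro ext_integral_shift std.prob_space_axioms measurable_f_terminal[OF assms] c(1)) simp
qed

text \<open>Fatou's lemma along \<open>min (minimal_concave w f (M n z)) n\<close>: the truncation keeps every Jensen step
  real-valued, and continuity on the fixed boundary identifies the limit.\<close>

lemma martingale_bellman_le_minimal_concave:
  assumes cont: "\<forall>x\<in>fixed_boundary w. continuous (at x within w) (minimal_concave w f)"
    and x: "x \<in> w"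
  shows "martingale_bellman w f x \<le> minimal_concave w f x"
  unfolding martingale_bellman_def
proof (rule Sup_least, safe)
  fix S M I assume mart: "w_martingale w S M I" and start: "starts_at M x"
  interpret w_martingale_space w S M I by standard fact
  let ?B = "minimal_concave w f"
  show "ext_integral std_space (\<lambda>z. f (I z)) \<le> ?B x"
  proof (cases "?B x = \<infinity>")
    case False
    then obtain r where r: "?B x = ereal r"
      using minimal_concave_ge[OF x] by (cases "?B x") auto
    then have rc: "c \<le> r" using minimal_concave_ge[OF x] by simp
    have Bninf: "?B y \<noteq> -\<infinity>" if "y \<in> w" for y using minimal_concave_ge[OF that] by auto
    have B: "locally_concave_on w ?B" and Bf: "\<And>y. y \<in> fixed_boundary w \<Longrightarrow> ereal (f y) \<le> ?B y"
      using minimal_concave_in_majorants by (auto simp: concave_majorants_def)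
    define h where "h K = (\<lambda>y. real_of_ereal (min (?B y) (ereal K)))" for K
    have h: "ereal (h K y) = min (?B y) (ereal K)" if "y \<in> w" for y K
      using Bninf[OF that] by (cases "?B y") (auto simp: h_def min_def)
    \<comment> \<open>The levels \<open>real n\<close> are nonnegative, so with
      \<open>c \<le> 0\<close> truncation does not push values below \<open>c\<close>.\<close>
    have h_ge: "c \<le> h (real n) y" if "y \<in> w" for y and n :: nat
    proof -
      have "ereal c \<le> min (?B y) (ereal (real n))" using minimal_concave_ge[OF that] c(1) by simp
      then show ?thesis unfolding h[OF that, symmetric] by simp
    qed
    \<comment> \<open>Subtracting \<open>c\<close> makes the sequence nonnegative, as Fatou's lemma
      requires.\<close>
    define u where "u n z = ennreal (h (real n) (M n z) - c)" for n z
    \<comment> \<open>The bound is independent of \<open>n\<close>: every truncation is at most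
      \<open>r\<close> at the starting point.\<close>
    have u_int: "(\<integral>\<^sup>+z. u n z \<partial>std_space) \<le> ennreal (r - c)" for n
    proof -
      have "(\<integral>\<^sup>+z. u n z \<partial>std_space) = ennreal (\<integral>z. h (real n) (M n z) - c \<partial>std_space)"
        unfolding u_def using h_ge M_in
        by (intro nn_integral_eq_integral integrable_M[of "\<lambda>y. h (real n) y - c"] AE_I2) auto
      also have "(\<integral>z. h (real n) (M n z) - c \<partial>std_space) = (\<integral>z. h (real n) (M n z) \<partial>std_space) - c"
        using integrable_M[of "h (real n)" n] by (simp add: std.prob_space[simplified])
      also have "(\<integral>z. h (real n) (M n z) \<partial>std_space) \<le> h (real n) x"
        unfolding h_def using B Bninf
        by (intro supermartingale concave_on_min_locally_concave start) auto
      also have "h (real n) x \<le> r"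
      proof -
        have "ereal (h (real n) x) \<le> ereal r" unfolding h[OF x] r by simp
        then show ?thesis by simp
      qed
      finally show ?thesis by (simp add: ennreal_leI)
    qed
    have "AE z in std_space. ennreal (f (I z) - c) \<le> liminf (\<lambda>n. u n z)"
      using M_tendsto
    proof (rule AE_mp, intro AE_I2 impI)
      fix z assume z: "z \<in> space std_space" and lim: "(\<lambda>n. M n z) \<longlonglongrightarrow> I z"
      have Iz: "I z \<in> fixed_boundary w" using z Minf_fixed by simp
      have "(\<lambda>n. ?B (M n z)) \<longlonglongrightarrow> ?B (I z)"
        using M_in z
        by (intro continuous_within_tendsto_compose[OF bspec[OF cont Iz] _ lim]) simp
      moreover have "(\<lambda>n. ereal (real n)) \<longlonglongrightarrow> \<infinity>"
        by (rule id_nat_ereal_tendsto_PInf)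
      \<comment> \<open>The truncation level grows with time and so disappears in the limit. The
        limit is taken in \<open>ereal\<close> because the minimal majorant may be infinite at
        \<open>I z\<close>.\<close>
      ultimately have "(\<lambda>n. min (?B (M n z)) (ereal (real n))) \<longlonglongrightarrow> min (?B (I z)) \<infinity>"
        by (rule tendsto_min)
      then have "(\<lambda>n. ereal (h (real n) (M n z))) \<longlonglongrightarrow> ?B (I z)"
        using M_in z by (simp add: h)
      then have "(\<lambda>n. ereal (h (real n) (M n z)) + ereal (- c)) \<longlonglongrightarrow> ?B (I z) + ereal (- c)"
        by (intro tendsto_add_ereal_general1 tendsto_const) auto
      then have "(\<lambda>n. e2ennreal (ereal (h (real n) (M n z) - c))) \<longlonglongrightarrow> e2ennreal (?B (I z) + ereal (- c))"
        by (intro tendsto_e2ennrealI) simp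
      then have "(\<lambda>n. u n z) \<longlonglongrightarrow> e2ennreal (?B (I z) + ereal (- c))"
        by (simp add: u_def e2ennreal_ereal)
      then have "liminf (\<lambda>n. u n z) = e2ennreal (?B (I z) + ereal (- c))"
        by (intro lim_imp_Liminf) auto
      moreover have "ennreal (f (I z) - c) \<le> e2ennreal (?B (I z) + ereal (- c))"
      proof -
        have "ereal (f (I z) - c) \<le> ?B (I z) + ereal (- c)"
          using add_right_mono[OF Bf[OF Iz], of "ereal (- c)"] by simp
        then show ?thesis using e2ennreal_mono by (metis e2ennreal_ereal)
      qed
      ultimately show "ennreal (f (I z) - c) \<le> liminf (\<lambda>n. u n z)" by simp
    qed
    then have "(\<integral>\<^sup>+z. ennreal (f (I z) - c) \<partial>std_space) \<le> (\<integral>\<^sup>+z. liminf (\<lambda>n. u n z) \<partial>std_space)"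
      by (rule nn_integral_mono_AE)
    also have "\<dots> \<le> liminf (\<lambda>n. \<integral>\<^sup>+z. u n z \<partial>std_space)"
      unfolding u_def using integrable_M
      by (intro nn_integral_liminf measurable_compose[OF _ measurable_ennreal] borel_measurable_integrable) auto
    also have "\<dots> \<le> liminf (\<lambda>n::nat. ennreal (r - c))"
      by (intro Liminf_mono always_eventually allI u_int)
    also have "\<dots> = ennreal (r - c)"
      by (simp add: Liminf_const)
    finally have "enn2ereal (\<integral>\<^sup>+z. ennreal (f (I z) - c) \<partial>std_space) \<le> ereal (r - c)"
      using rc by (metis diff_ge_0_iff_ge enn2ereal_ennreal less_eq_ennreal.rep_eq)
    then show ?thesis
      unfolding ext_integral_terminal[OF mart] r
      by (cases "enn2ereal (\<integral>\<^sup>+z. ennreal (f (I z) - c) \<partial>std_space)") auto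
  qed simp
qed

section \<open>The martingale Bellman function is a majorant\<close>

definition attained :: "'a \<Rightarrow> ereal set" where
  "attained x = {ext_integral std_space (\<lambda>z. f (I z)) | S M I. w_martingale w S M I \<and> starts_at M x}"

lemma attainedI:
  "w_martingale w S M I \<Longrightarrow> starts_at M x \<Longrightarrow> ext_integral std_space (\<lambda>z. f (I z)) \<in> attained x"
  unfolding attained_def by blast

lemma martingale_bellman_eq_Sup: "martingale_bellman w f x = Sup (attained x)"
  by (simp add: martingale_bellman_def attained_def)

text \<open>Strong martingale connectedness supplies a competitor at each point; the supremum of an
  empty set would be -infinity.\<close>

lemma attained_nonempty:
  assumes "x \<in> w" shows "attained x \<noteq> {}"
  using connected assms
  unfolding strongly_martingale_connected_def simple_w_martingale_def attained_def by blast

lemma attained_ge: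
  assumes "e \<in> attained x" shows "ereal c \<le> e"
  using assms enn2ereal_nonneg add_right_mono[of 0 _ "ereal c"]
  by (auto simp: attained_def ext_integral_terminal)

lemma martingale_bellman_ge:
  assumes "x \<in> w" shows "ereal c \<le> martingale_bellman w f x"
  unfolding martingale_bellman_eq_Sup
  using attained_nonempty[OF assms] attained_ge[of _ x] by (meson Sup_upper2 ex_in_conv)

lemma attained_convex_combination:
  assumes s: "0 < s" "s < 1" and seg: "closed_segment a b \<subseteq> w"
    and ab: "e \<in> attained a" "e' \<in> attained b"
  shows "ereal s * e + ereal (1 - s) * e' \<in> attained (s *\<^sub>R a + (1 - s) *\<^sub>R b)"
proof -
  obtain S M I where e: "e = ext_integral std_space (\<lambda>z. f (I z))" and M: "w_martingale w S M I" "starts_at M a"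
    using ab(1) by (auto simp: attained_def)
  obtain T N J where e': "e' = ext_integral std_space (\<lambda>z. f (J z))" and N: "w_martingale w T N J" "starts_at N b"
    using ab(2) by (auto simp: attained_def)
  note L = w_martingale_glue[OF s M N seg]
  note [measurable] = measurable_f_terminal[OF M(1)] measurable_f_terminal[OF N(1)]
  define P where "P = (\<integral>\<^sup>+z. ennreal (f (I z) - c) \<partial>std_space)"
  define Q where "Q = (\<integral>\<^sup>+z. ennreal (f (J z) - c) \<partial>std_space)"
  have "ext_integral std_space (\<lambda>z. f (glue s I J z)) =
      enn2ereal (\<integral>\<^sup>+z. ennreal (f (glue s I J z) - c) \<partial>std_space) + ereal c"
    by (rule ext_integral_terminal[OF L(1)])
  also have "(\<integral>\<^sup>+z. ennreal (f (glue s I J z) - c) \<partial>std_space) = ennreal s * P + ennreal (1 - s) * Q"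
    unfolding glue_apply[of "\<lambda>v. ennreal (f v - c)"] P_def Q_def
    by (rule nn_integral_glue[OF s]) auto
  \<comment> \<open>The shift splits as \<open>c = s * c + (1 - s) * c\<close>. Since
    \<open>P\<close> and \<open>Q\<close> are nonnegative, no difference of infinities
    arises.\<close>
  also have "enn2ereal (ennreal s * P + ennreal (1 - s) * Q) + ereal c =
      ereal s * (enn2ereal P + ereal c) + ereal (1 - s) * (enn2ereal Q + ereal c)"
    using s enn2ereal_nonneg[of P] enn2ereal_nonneg[of Q]
    by (cases "enn2ereal P"; cases "enn2ereal Q")
       (auto simp: plus_ennreal.rep_eq times_ennreal.rep_eq enn2ereal_ennreal algebra_simps)
  finally have "ext_integral std_space (\<lambda>z. f (glue s I J z)) = ereal s * e + ereal (1 - s) * e'"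
    unfolding e e' ext_integral_terminal[OF M(1)] ext_integral_terminal[OF N(1)] P_def Q_def .
  then show ?thesis using attainedI[OF L] by simp
qed

text \<open>Two suprema are taken in turn, with \<open>e\<close> fixed during the one over
  \<open>attained b\<close>. Moving a summand through a supremum in \<open>ereal\<close> requires a
  nonempty index set and a summand other than -infinity; the lower bound \<open>c\<close> secures
  the latter.\<close>

lemma martingale_bellman_concave:
  assumes s: "0 < s" "s < 1" and seg: "closed_segment a b \<subseteq> w"
  shows "ereal s * martingale_bellman w f a + ereal (1 - s) * martingale_bellman w f b
    \<le> martingale_bellman w f (s *\<^sub>R a + (1 - s) *\<^sub>R b)" (is "_ \<le> ?R")
proof -
  have ab: "a \<in> w" "b \<in> w" using seg by auto
  have ne: "attained a \<noteq> {}" "attained b \<noteq> {}" using attained_nonempty ab by auto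
  have Bb: "ereal (1 - s) * martingale_bellman w f b \<noteq> -\<infinity>"
    using martingale_bellman_ge[OF ab(2)] s by (cases "martingale_bellman w f b") auto
  have "ereal s * e + ereal (1 - s) * martingale_bellman w f b \<le> ?R" if e: "e \<in> attained a" for e
  proof -
    have e_ninf: "ereal s * e \<noteq> -\<infinity>" using attained_ge[OF e] s by (cases e) auto
    have "ereal s * e + ereal (1 - s) * martingale_bellman w f b =
        (SUP e'\<in>attained b. ereal (1 - s) * e') + ereal s * e"
      unfolding martingale_bellman_eq_Sup
      using Sup_ereal_mult_left'[OF ne(2), of "1 - s" "\<lambda>e. e"] s by (simp add: add.commute)
    also have "\<dots> = (SUP e'\<in>attained b. ereal (1 - s) * e' + ereal s * e)"
      by (rule SUP_ereal_add_left[OF ne(2) e_ninf, symmetric])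
    also have "\<dots> \<le> ?R"
      unfolding martingale_bellman_eq_Sup[of "s *\<^sub>R a + (1 - s) *\<^sub>R b"]
      using attained_convex_combination[OF s seg e]
      by (intro SUP_least Sup_upper) (simp add: add.commute)
    finally show ?thesis .
  qed
  then have "(SUP e\<in>attained a. ereal s * e + ereal (1 - s) * martingale_bellman w f b) \<le> ?R"
    by (intro SUP_least)
  also have "(SUP e\<in>attained a. ereal s * e + ereal (1 - s) * martingale_bellman w f b) =
      (SUP e\<in>attained a. ereal s * e) + ereal (1 - s) * martingale_bellman w f b"
    by (rule SUP_ereal_add_left[OF ne(1) Bb])
  also have "(SUP e\<in>attained a. ereal s * e) = ereal s * martingale_bellman w f a"
    unfolding martingale_bellman_eq_Sup
    using Sup_ereal_mult_left'[OF ne(1), of s "\<lambda>e. e"] s by simp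
  finally show ?thesis .
qed

text \<open>The martingale that stays at \<open>x\<close>, with the trivial filtration, has payoff
  \<open>f x\<close>.\<close>

lemma martingale_bellman_ge_f:
  assumes x: "x \<in> fixed_boundary w"
  shows "ereal (f x) \<le> martingale_bellman w f x"
proof -
  have "x \<in> w" using fixed_boundary_subset[OF closed_w] x by blast
  have "algebra {0..1::real} {{}, {0..1}}" by (auto simp: algebra_iff_Un)
  moreover have "{0..1} \<in> sets std_space" using sets.top[of std_space] by simp
  moreover have "convex hull ((\<lambda>_. x) ` \<sigma> \<union> (\<lambda>_. x) ` \<sigma>) \<subseteq> w" for \<sigma> :: "real set"
  proof -
    have "convex hull ((\<lambda>_. x) ` \<sigma> \<union> (\<lambda>_. x) ` \<sigma>) \<subseteq> {x}" by (intro hull_minimal) auto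
    then show ?thesis using \<open>x \<in> w\<close> by blast
  qed
  ultimately have "w_martingale w (\<lambda>_. {{}, {0..1}}) (\<lambda>_ _. x) (\<lambda>_. x)"
    using x by (auto simp: w_martingale_def finite_filtration_def is_cond_exp_def)
  then have "ext_integral std_space (\<lambda>z. f x) \<in> attained x"
    by (rule attainedI) (simp add: starts_at_def)
  moreover have "ext_integral std_space (\<lambda>z. f x) = ereal (f x)"
    using std.emeasure_space_1
    by (cases "0 \<le> f x") (auto simp: ext_integral_def enn2ereal_ennreal ennreal_neg zero_ennreal.rep_eq)
  ultimately show ?thesis
    unfolding martingale_bellman_eq_Sup by (metis Sup_upper)
qed

lemma martingale_bellman_in_majorants: "martingale_bellman w f \<in> concave_majorants w f"
  unfolding concave_majorants_def
proof (intro CollectI conjI ballI)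
  fix x assume "x \<in> w"
  then show "martingale_bellman w f x \<noteq> -\<infinity>" using martingale_bellman_ge[of x] by auto
next
  fix x assume "x \<in> fixed_boundary w"
  then show "ereal (f x) \<le> martingale_bellman w f x" by (rule martingale_bellman_ge_f)
next
  show "locally_concave_on w (martingale_bellman w f)"
    unfolding locally_concave_on_def ext_concave_on_def
  proof (intro allI impI conjI ballI)
    fix a b :: 'a assume seg: "closed_segment a b \<subseteq> w"
    show "convex (closed_segment a b)" by simp
    fix x assume x: "x \<in> closed_segment a b"
    then show "martingale_bellman w f x \<noteq> -\<infinity>" using martingale_bellman_ge[of x] seg by auto
    fix y and t :: real assume y: "y \<in> closed_segment a b" and t: "t \<in> {0..1}"
    have "closed_segment x y \<subseteq> w"
      using x y seg by (meson closed_segment_subset convex_closed_segment subset_trans)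
    \<comment> \<open>Gluing requires a break point strictly inside the interval, namely
      \<open>s = 1 - t\<close>. At the ends the inequality is trivial, since zero times an infinite
      value is zero in \<open>ereal\<close>.\<close>
    consider "t = 0" | "t = 1" | "0 < 1 - t" "1 - t < 1" using t by fastforce
    then show "ereal (1 - t) * martingale_bellman w f x + ereal t * martingale_bellman w f y
        \<le> martingale_bellman w f ((1 - t) *\<^sub>R x + t *\<^sub>R y)"
    proof cases
      case 3
      then show ?thesis
        using martingale_bellman_concave[OF 3 \<open>closed_segment x y \<subseteq> w\<close>] by simp
    qed (auto simp flip: zero_ereal_def one_ereal_def)
  qed
qed

end

theorem theorem2p21:
  fixes w :: "'a::euclidean_space set" and f :: "'a \<Rightarrow> real"
  assumes "closed w"
    and "strongly_martingale_connected w"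
    and "f \<in> borel_measurable (restrict_space borel (fixed_boundary w))"
    and "locally_bounded_on (fixed_boundary w) f"
    and "bdd_below (f ` fixed_boundary w)"
    and "\<forall>x\<in>fixed_boundary w. continuous (at x within w) (minimal_concave w f)"
  shows "\<forall>x\<in>w. minimal_concave w f x = martingale_bellman w f x"
proof
  fix x assume x: "x \<in> w"
  obtain c0 where "\<And>y. y \<in> fixed_boundary w \<Longrightarrow> c0 \<le> f y"
    using assms(5) by (auto simp: bdd_below_def)
  \<comment> \<open>A nonpositive bound is chosen so that \<open>- c\<close> is nonnegative in the
    shifted integrals and truncation levels \<open>real n\<close> stay above
    \<open>c\<close>.\<close>
  then have c: "min c0 0 \<le> 0" "\<And>y. y \<in> fixed_boundary w \<Longrightarrow> min c0 0 \<le> f y"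
    by (auto simp: min.coboundedI1)
  have "minimal_concave w f x \<le> martingale_bellman w f x"
    unfolding minimal_concave_def
    by (rule INF_lower[OF martingale_bellman_in_majorants[OF assms(1-3) c]])
  moreover have "martingale_bellman w f x \<le> minimal_concave w f x"
    by (rule martingale_bellman_le_minimal_concave[OF assms(1-3) c assms(6) x])
  ultimately show "minimal_concave w f x = martingale_bellman w f x" by (rule antisym)
qed

end
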